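(* Assume $f:\mathbb{R}^N\to\mathbb{R}$ is a smooth convex function that is partially separable of degree $\omega$ ($\omega\geq 1$ an integer) and has block Lipschitz gradient with constants $L_1,\dots,L_n>0$. Assume further that $\Psi\equiv0$. Then the separable quadratic approximation generalization of DQAM (Method I in the context) coincides with the fully parallel coordinate descent method (Method II in the context) under the choice of parameters $$C_i(x_k)\equiv L_iB_i\quad(i=1,\dots,n),\qquad \theta=\tfrac1\omega .$$ That is, started from the same point $x_0\in\mathbb{R}^N$, the two methods generate the same sequence of iterates $\{x_k\}_{k\ge0}$.
   Context: Blocks: $N=\sum_{i=1}^nN_i$; the $N\times N$ identity matrix is partitioned columnwise as $I=[U_1,\dots,U_n]$ with $U_i\in\mathbb{R}^{N\times N_i}$, and $x^{(i)}=U_i^Tx\in\mathbb{R}^{N_i}$ for $x\in\mathbb{R}^N$. For each $i$ a positive definite matrix $B_i\in\mathbb{R}^{N_i\times N_i}$ is fixed, with $\|t\|_{(i)}=\langle B_it,t\rangle^{1/2}$ and conjugate norm $\|s\|_{(i)}^*=\langle B_i^{-1}s,s\rangle^{1/2}$. $f'$ denotes the gradient of $f$. Partial separability: a smooth convex $f$ is partially separable of degree $\omega$ if there is a collection $\mathcal{J}$ of subsets of $\{1,\dots,n\}$ with $f=\sum_{J\in\mathcal{J}}f_J$ and $\max_{J\in\mathcal{J}}|J|\le\omega$, where each $f_J$ is a smooth convex function depending only on $x^{(i)}$, $i\in J$. Block Lipschitz gradient: for all $x\in\mathbb{R}^N$, all $i$ and all $t\in\mathbb{R}^{N_i}$, $\|(f'(x+U_it))^{(i)}-(f'(x))^{(i)}\|_{(i)}^*\le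 L_i\|t\|_{(i)}$. Both methods aim to minimize $f+\Psi$. Method I (generalization of DQAM, separable quadratic approximation), with positive semidefinite matrices $C_i(x)\in\mathbb{R}^{N_i\times N_i}$ and stepsize parameter $\theta$: for $k=0,1,2,\dots$, $$h_k=\arg\min_{h\in\mathbb{R}^N}\Big\{f(x_k)+\langle f'(x_k),h\rangle+\tfrac12\sum_{i=1}^n\langle C_i(x_k)h^{(i)},h^{(i)}\rangle+\Psi(x_k+h)\Big\},$$ $$y_k=x_k+h_k,\qquad x_{k+1}=(1-\theta)x_k+\theta y_k.$$ Method II (fully parallel coordinate descent method): for $k=0,1,2,\dots$, $$h_k=\arg\min_{h\in\mathbb{R}^N}\Big\{f(x_k)+\langle f'(x_k),h\rangle+\tfrac\omega2\sum_{i=1}^n\langle L_iB_ih^{(i)},h^{(i)}\rangle+\Psi(x_k+h)\Big\},\qquad x_{k+1}=x_k+h_k.$$ *)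

theory Defs
  imports "HOL-Analysis.Analysis" "Jordan_Normal_Form.Gauss_Jordan_Elimination"
begin

no_notation Matrix.vec_index (infixl "$" 100)
no_notation Matrix.scalar_prod (infix "\<bullet>" 70)
hide_const (open) Finite_Cartesian_Product.vec Finite_Cartesian_Product.mat
hide_type (open) Finite_Cartesian_Product.vec

type_synonym 'N rvec = "(real, 'N) Finite_Cartesian_Product.vec"

text \<open>
  The ambient space \<open>\<real>\<^sup>N\<close> is \<open>real ^ 'N\<close> with \<open>'N\<close> finite and linearly ordered.  The block
  spaces \<open>\<real>\<^bsup>N_i\<^esup>\<close>, whose dimensions vary with \<open>i\<close>, are \<open>carrier_vec (d i)\<close> where \<open>d i\<close>
  stands for \<open>N_i\<close>, and the blocks are numbered \<open>0, \<dots>, n - 1\<close>.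
\<close>

text \<open>The coordinate with (zero-based) number \<open>k\<close> of \<open>real ^ 'N\<close>, for \<open>k < CARD('N)\<close>.\<close>

definition coord :: "nat \<Rightarrow> 'N::{finite,linorder}" where
  "coord k = sorted_list_of_set UNIV ! k"

text \<open>
  Block \<open>i\<close> of the identity matrix consists of the \<open>d i\<close> columns following the first
  \<open>d 0 + \<dots> + d (i - 1)\<close> ones; \<open>blk_emb d i t\<close> is \<open>U_i t\<close>, the linear combination of these
  columns with coefficients \<open>t\<close>, and \<open>blk d i x\<close> is \<open>x\<^bsup>(i)\<^esup> = U_i\<^sup>T x\<close>.
\<close>

definition blk_coord :: "(nat \<Rightarrow> nat) \<Rightarrow> nat \<Rightarrow> nat \<Rightarrow> 'N::{finite,linorder}" where
  "blk_coord d i j = coord ((\<Sum>l<i. d l) + j)"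

definition blk_emb :: "(nat \<Rightarrow> nat) \<Rightarrow> nat \<Rightarrow> real Matrix.vec \<Rightarrow> ('N::{finite,linorder}) rvec" where
  "blk_emb d i t = (\<Sum>j<d i. vec_index t j *\<^sub>R axis (blk_coord d i j) 1)"

definition blk :: "(nat \<Rightarrow> nat) \<Rightarrow> nat \<Rightarrow> ('N::{finite,linorder}) rvec \<Rightarrow> real Matrix.vec" where
  "blk d i x = Matrix.vec (d i) (\<lambda>j. x $ blk_coord d i j)"

definition pos_def_mat :: "nat \<Rightarrow> real Matrix.mat \<Rightarrow> bool" where
  "pos_def_mat m A \<longleftrightarrow> A \<in> carrier_mat m m \<and> transpose_mat A = A \<and>
     (\<forall>t\<in>carrier_vec m. t \<noteq> 0\<^sub>v m \<longrightarrow> scalar_prod (A *\<^sub>v t) t > 0)"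

text \<open>
  The conjugate norm is only used for positive definite \<open>B\<close>, for which \<open>mat_inverse B\<close> is
  \<open>Some\<close> of the inverse matrix.
\<close>

definition blk_norm :: "real Matrix.mat \<Rightarrow> real Matrix.vec \<Rightarrow> real" where
  "blk_norm B t = sqrt (scalar_prod (B *\<^sub>v t) t)"

definition blk_conj_norm :: "real Matrix.mat \<Rightarrow> real Matrix.vec \<Rightarrow> real" where
  "blk_conj_norm B s = sqrt (scalar_prod (the (mat_inverse B) *\<^sub>v s) s)"

text \<open>
  Smoothness is differentiability on the whole space; for convex functions this already
  implies that the gradient is continuous.
\<close>

definition smooth_convex :: "('a::real_normed_vector \<Rightarrow> real) \<Rightarrow> bool" where
  "smooth_convex f \<longleftrightarrow> f differentiable_on UNIV \<and> convex_on UNIV f"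

definition depends_only_on_blks ::
  "(nat \<Rightarrow> nat) \<Rightarrow> nat set \<Rightarrow> (('N::{finite,linorder}) rvec \<Rightarrow> real) \<Rightarrow> bool" where
  "depends_only_on_blks d J g \<longleftrightarrow>
     (\<forall>x y. (\<forall>i\<in>J. blk d i x = blk d i y) \<longrightarrow> g x = g y)"

definition partially_separable ::
  "nat \<Rightarrow> (nat \<Rightarrow> nat) \<Rightarrow> nat \<Rightarrow> (('N::{finite,linorder}) rvec \<Rightarrow> real) \<Rightarrow> bool" where
  "partially_separable n d \<omega> f \<longleftrightarrow>
     (\<exists>\<J> F. \<J> \<subseteq> Pow {..<n} \<and>
        (\<forall>x. f x = (\<Sum>J\<in>\<J>. F J x)) \<and>
        (\<forall>J\<in>\<J>. card J \<le> \<omega> \<and> smooth_convex (F J) \<and> depends_only_on_blks d J (F J)))"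

definition block_lipschitz_grad ::
  "nat \<Rightarrow> (nat \<Rightarrow> nat) \<Rightarrow> (nat \<Rightarrow> real Matrix.mat) \<Rightarrow> (nat \<Rightarrow> real) \<Rightarrow>
    (('N::{finite,linorder}) rvec \<Rightarrow> 'N rvec) \<Rightarrow> bool" where
  "block_lipschitz_grad n d B L f' \<longleftrightarrow>
     (\<forall>x. \<forall>i<n. \<forall>t\<in>carrier_vec (d i).
        blk_conj_norm (B i) (blk d i (f' (x + blk_emb d i t)) - blk d i (f' x))
          \<le> L i * blk_norm (B i) t)"

text \<open>
  A run of a method is a sequence of iterates \<open>x\<close> started at \<open>x0\<close> in which every step is made
  with some minimizer \<open>h\<close> of the respective model.
\<close>

definition sqa_model ::
  "nat \<Rightarrow> (nat \<Rightarrow> nat) \<Rightarrow> (nat \<Rightarrow> ('N::{finite,linorder}) rvec \<Rightarrow> real Matrix.mat) \<Rightarrow>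
    ('N rvec \<Rightarrow> real) \<Rightarrow> ('N rvec \<Rightarrow> 'N rvec) \<Rightarrow> ('N rvec \<Rightarrow> real) \<Rightarrow>
    'N rvec \<Rightarrow> 'N rvec \<Rightarrow> real" where
  "sqa_model n d C f f' \<Psi> x h =
     f x + f' x \<bullet> h + 1 / 2 * (\<Sum>i<n. scalar_prod (C i x *\<^sub>v blk d i h) (blk d i h)) + \<Psi> (x + h)"

definition sqa_run ::
  "nat \<Rightarrow> (nat \<Rightarrow> nat) \<Rightarrow> (nat \<Rightarrow> ('N::{finite,linorder}) rvec \<Rightarrow> real Matrix.mat) \<Rightarrow> real \<Rightarrow>
    ('N rvec \<Rightarrow> real) \<Rightarrow> ('N rvec \<Rightarrow> 'N rvec) \<Rightarrow> ('N rvec \<Rightarrow> real) \<Rightarrow>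
    'N rvec \<Rightarrow> (nat \<Rightarrow> 'N rvec) \<Rightarrow> bool" where
  "sqa_run n d C \<theta> f f' \<Psi> x0 x \<longleftrightarrow> x 0 = x0 \<and>
     (\<forall>k. \<exists>h y. is_arg_min (sqa_model n d C f f' \<Psi> (x k)) (\<lambda>_. True) h \<and>
        y = x k + h \<and> x (Suc k) = (1 - \<theta>) *\<^sub>R x k + \<theta> *\<^sub>R y)"

definition pcdm_model ::
  "nat \<Rightarrow> (nat \<Rightarrow> nat) \<Rightarrow> (nat \<Rightarrow> real Matrix.mat) \<Rightarrow> (nat \<Rightarrow> real) \<Rightarrow> nat \<Rightarrow>
    (('N::{finite,linorder}) rvec \<Rightarrow> real) \<Rightarrow> ('N rvec \<Rightarrow> 'N rvec) \<Rightarrow> ('N rvec \<Rightarrow> real) \<Rightarrow>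
    'N rvec \<Rightarrow> 'N rvec \<Rightarrow> real" where
  "pcdm_model n d B L \<omega> f f' \<Psi> x h =
     f x + f' x \<bullet> h
       + real \<omega> / 2 * (\<Sum>i<n. scalar_prod ((L i \<cdot>\<^sub>m B i) *\<^sub>v blk d i h) (blk d i h)) + \<Psi> (x + h)"

definition pcdm_run ::
  "nat \<Rightarrow> (nat \<Rightarrow> nat) \<Rightarrow> (nat \<Rightarrow> real Matrix.mat) \<Rightarrow> (nat \<Rightarrow> real) \<Rightarrow> nat \<Rightarrow>
    (('N::{finite,linorder}) rvec \<Rightarrow> real) \<Rightarrow> ('N rvec \<Rightarrow> 'N rvec) \<Rightarrow> ('N rvec \<Rightarrow> real) \<Rightarrow>
    'N rvec \<Rightarrow> (nat \<Rightarrow> 'N rvec) \<Rightarrow> bool" where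
  "pcdm_run n d B L \<omega> f f' \<Psi> x0 x \<longleftrightarrow> x 0 = x0 \<and>
     (\<forall>k. \<exists>h. is_arg_min (pcdm_model n d B L \<omega> f f' \<Psi> (x k)) (\<lambda>_. True) h \<and>
        x (Suc k) = x k + h)"

end

theory Submission
  imports Defs
begin

text \<open>
  The quadratic term is a positive definite symmetric bilinear form \<open>b\<close>, so for the
  \<open>p\<close> with \<open>b p = - \<langle>f' x, \<cdot>\<rangle>\<close> completing the square shows that the model with curvature factor
  \<open>c > 0\<close> has the unique minimizer \<open>p / c\<close>.  Method I takes a \<open>1 / \<omega>\<close> fraction of the step for
  \<open>c = 1\<close>, Method II the full step for \<open>c = \<omega>\<close>, and both are \<open>p / \<omega>\<close>.
\<close>

text \<open>This is the Riesz representation with \<open>b\<close> in place of the inner product.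
  The operator \<open>A\<close> with \<open>A u \<bullet> v = b u v\<close> is injective because
  \<open>b u u > 0\<close> for nonzero \<open>u\<close>, hence surjective in finite dimension, and
  \<open>p\<close> is a preimage of \<open>g\<close>.\<close>

lemma bilinear_form_representation:
  fixes b :: "'a::euclidean_space \<Rightarrow> 'a \<Rightarrow> real"
  assumes b: "bilinear b" and pos: "\<And>u. u \<noteq> 0 \<Longrightarrow> b u u > 0"
  obtains p where "\<And>v. b p v = g \<bullet> v"
proof -
  define A where "A u = (\<Sum>e\<in>Basis. b u e *\<^sub>R e)" for u
  have A: "A u \<bullet> v = b u v" for u v
  proof -
    have "b u v = b u (\<Sum>e\<in>Basis. (v \<bullet> e) *\<^sub>R e)"
      by (simp add: euclidean_representation)
    also have "\<dots> = (\<Sum>e\<in>Basis. (v \<bullet> e) * b u e)"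
      using b by (simp add: bilinear_def linear_sum linear_cmul)
    finally show ?thesis
      by (simp add: A_def inner_sum_left inner_commute[of v] mult.commute)
  qed
  have "linear A"
    using b unfolding A_def
    by (intro linearI)
      (simp_all add: bilinear_ladd bilinear_lmul scaleR_add_left sum.distrib scaleR_sum_right)
  moreover have "inj A"
  proof -
    have "u = 0" if "A u = 0" for u
      using A[of u u] pos[of u] that by fastforce
    then show ?thesis
      using \<open>linear A\<close> by (simp add: linear_injective_0)
  qed
  ultimately have "surj A"
    by (rule linear_injective_imp_surjective) simp
  then obtain p where "A p = g"
    by (metis surjD)
  then show thesis
    using A that by metis
qed

lemma quadratic_model_minimizer:
  fixes b :: "'a::euclidean_space \<Rightarrow> 'a \<Rightarrow> real"
  assumes b: "bilinear b" and sym: "\<And>u v. b u v = b v u"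
    and pos: "\<And>u. u \<noteq> 0 \<Longrightarrow> b u u > 0"
    and p: "\<And>v. b p v = - (g \<bullet> v)" and c: "c > 0"
  shows "is_arg_min (\<lambda>h. a + g \<bullet> h + c / 2 * b h h) (\<lambda>_. True) h \<longleftrightarrow> h = (1 / c) *\<^sub>R p"
proof -
  define q where "q = (1 / c) *\<^sub>R p"
  \<comment> \<open>\<open>q\<close> is the stationary point: the linear term equals
    \<open>- c * b q h\<close>, which by symmetry is exactly the cross term of
    \<open>c / 2 * b (h - q) (h - q)\<close>.\<close>
  have g: "g \<bullet> v = - (c * b q v)" for v
    using p[of v] c by (simp add: q_def bilinear_lmul[OF b])
  have eq: "a + g \<bullet> h + c / 2 * b h h = a - c / 2 * b q q + c / 2 * b (h - q) (h - q)" for h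
    by (simp add: g bilinear_lsub[OF b] bilinear_rsub[OF b] sym[of h q] field_simps)
  have nonneg: "b (h - q) (h - q) \<ge> 0" for h
    using pos[of "h - q"] bilinear_lzero[OF b, of 0] by (cases "h = q") auto
  show ?thesis
  proof
    assume "h = (1 / c) *\<^sub>R p"
    then show "is_arg_min (\<lambda>h. a + g \<bullet> h + c / 2 * b h h) (\<lambda>_. True) h"
      using nonneg c unfolding eq
      by (auto simp: is_arg_min_def q_def[symmetric] bilinear_lzero[OF b] not_less)
  next
    assume "is_arg_min (\<lambda>h. a + g \<bullet> h + c / 2 * b h h) (\<lambda>_. True) h"
    \<comment> \<open>The competitor is \<open>q\<close>, where the square vanishes, so minimality
      of \<open>h\<close> leaves no room for a positive \<open>b (h - q) (h - q)\<close>.\<close>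
    then have "\<not> c / 2 * b (q - q) (q - q) < c / 2 * b (h - q) (h - q)"
      unfolding eq is_arg_min_def by (metis add_less_cancel_left)
    then have "h - q = 0"
      using pos[of "h - q"] c bilinear_lzero[OF b, of 0] by (auto simp: zero_less_mult_iff)
    then show "h = (1 / c) *\<^sub>R p"
      by (simp add: q_def)
  qed
qed

lemma blk_carrier [simp]: "blk d i x \<in> carrier_vec (d i)"
  by (simp add: blk_def)

lemma blk_add: "blk d i (x + y) = blk d i x + blk d i y"
  by (intro eq_vecI) (auto simp: blk_def)

lemma blk_scaleR: "blk d i (r *\<^sub>R x) = r \<cdot>\<^sub>v blk d i x"
  by (intro eq_vecI) (auto simp: blk_def)

text \<open>Translates a global coordinate number into a block \<open>i\<close> and an offset
  \<open>j\<close>. In the induction, \<open>k\<close> lies either before the last block or inside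
  it, at offset \<open>k\<close> minus the total length of the earlier blocks.\<close>

lemma less_sum_nat_split:
  fixes d :: "nat \<Rightarrow> nat"
  assumes "k < (\<Sum>l<n. d l)"
  obtains i j where "i < n" "j < d i" "k = (\<Sum>l<i. d l) + j"
  using assms
proof (induction n arbitrary: thesis)
  case 0
  then show ?case by simp
next
  case (Suc n)
  show ?case
  proof (cases "k < (\<Sum>l<n. d l)")
    case True
    then show ?thesis
      using Suc.IH Suc.prems(1) less_SucI by metis
  next
    case False
    then show ?thesis
      using Suc.prems by (intro Suc.prems(1)[of n "k - (\<Sum>l<n. d l)"]) auto
  qed
qed

lemma coord_surj:
  obtains k where "k < CARD('N::{finite,linorder})" "(a::'N) = coord k"
proof -
  have "a \<in> set (sorted_list_of_set UNIV)"
    by simp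
  then show thesis
    using that unfolding coord_def in_set_conv_nth by auto
qed

text \<open>Since the block dimensions add up to \<open>CARD('N)\<close>, every coordinate lies in
  some block. This carries definiteness from the single blocks over to the whole space.\<close>

lemma blk_zeroD:
  fixes x :: "('N::{finite,linorder}) rvec"
  assumes dim: "CARD('N) = (\<Sum>i<n. d i)" and zero: "\<And>i. i < n \<Longrightarrow> blk d i x = 0\<^sub>v (d i)"
  shows "x = 0"
proof -
  have "x $ a = 0" for a
  proof -
    obtain k where "k < CARD('N)" and a: "a = coord k"
      by (rule coord_surj)
    then obtain i j where ij: "i < n" "j < d i" and "k = (\<Sum>l<i. d l) + j"
      using less_sum_nat_split dim by metis
    then have "x $ a = vec_index (blk d i x) j"
      by (simp add: a blk_def blk_coord_def)
    then show ?thesis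
      using ij zero by simp
  qed
  then show ?thesis
    by (simp add: Finite_Cartesian_Product.vec_eq_iff)
qed

text \<open>The polar form of the quadratic term in both models: its diagonal is that term, and two
  separate arguments make bilinearity available.\<close>

definition blk_form ::
  "nat \<Rightarrow> (nat \<Rightarrow> nat) \<Rightarrow> (nat \<Rightarrow> real Matrix.mat) \<Rightarrow> ('N::{finite,linorder}) rvec \<Rightarrow> 'N rvec \<Rightarrow> real"
  where "blk_form n d A u v = (\<Sum>i<n. scalar_prod (A i *\<^sub>v blk d i u) (blk d i v))"

lemma bilinear_blk_form:
  assumes A: "\<And>i. i < n \<Longrightarrow> A i \<in> carrier_mat (d i) (d i)"
  shows "bilinear (blk_form n d A :: ('N::{finite,linorder}) rvec \<Rightarrow> _)"
proof -
  \<comment> \<open>The vector and matrix laws used summand by summand below hold only for matching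
    dimensions; this fact supplies the side conditions for each \<open>i < n\<close>.\<close>
  have Ablk: "A i *\<^sub>v blk d i u \<in> carrier_vec (d i)" if "i < n" for i and u :: "'N rvec"
    using A[OF that] by (auto intro: mult_mat_vec_carrier)
  have add_left: "blk_form n d A (u + u') v = blk_form n d A u v + blk_form n d A u' v"
    for u u' v :: "'N rvec"
    unfolding blk_form_def sum.distrib[symmetric] blk_add
    by (intro sum.cong)
      (auto simp: mult_add_distrib_mat_vec[OF A] intro!: add_scalar_prod_distrib Ablk)
  have add_right: "blk_form n d A u (v + v') = blk_form n d A u v + blk_form n d A u v'"
    for u v v' :: "'N rvec"
    unfolding blk_form_def sum.distrib[symmetric] blk_add
    by (intro sum.cong) (auto intro!: scalar_prod_add_distrib Ablk)
  have scale_left: "blk_form n d A (r *\<^sub>R u) v = r * blk_form n d A u v"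
    for r and u v :: "'N rvec"
    unfolding blk_form_def sum_distrib_left blk_scaleR
    by (intro sum.cong) (auto simp: mult_mat_vec[OF A] intro!: smult_scalar_prod_distrib Ablk)
  have scale_right: "blk_form n d A u (r *\<^sub>R v) = r * blk_form n d A u v"
    for r and u v :: "'N rvec"
    unfolding blk_form_def sum_distrib_left blk_scaleR
    by (intro sum.cong) (auto intro!: scalar_prod_smult_distrib Ablk)
  show ?thesis
    unfolding bilinear_def
    by (auto intro!: linearI simp: add_left add_right scale_left scale_right)
qed

lemma blk_form_sym:
  assumes A: "\<And>i. i < n \<Longrightarrow> A i \<in> carrier_mat (d i) (d i)"
    and sym: "\<And>i. i < n \<Longrightarrow> transpose_mat (A i) = A i"
  shows "blk_form n d A u v = blk_form n d A v u"
  unfolding blk_form_def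
proof (intro sum.cong refl)
  fix i assume "i \<in> {..<n}"
  then have i: "i < n" by simp
  have "scalar_prod (A i *\<^sub>v blk d i u) (blk d i v) = scalar_prod (blk d i u) (A i *\<^sub>v blk d i v)"
    using transpose_vec_mult_scalar[OF A[OF i], of "blk d i v" "blk d i u"] sym[OF i] by simp
  also have "\<dots> = scalar_prod (A i *\<^sub>v blk d i v) (blk d i u)"
    by (intro comm_scalar_prod[of _ "d i"] mult_mat_vec_carrier[OF A[OF i]]) simp_all
  finally show "scalar_prod (A i *\<^sub>v blk d i u) (blk d i v)
      = scalar_prod (A i *\<^sub>v blk d i v) (blk d i u)" .
qed

text \<open>A nonzero \<open>u\<close> has a nonzero block, whose summand is positive, and no other
  summand is negative.\<close>

lemma blk_form_pos:
  fixes u :: "('N::{finite,linorder}) rvec"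
  assumes dim: "CARD('N) = (\<Sum>i<n. d i)" and A: "\<And>i. i < n \<Longrightarrow> pos_def_mat (d i) (A i)"
    and u: "u \<noteq> 0"
  shows "blk_form n d A u u > 0"
proof -
  have pos: "scalar_prod (A i *\<^sub>v blk d i u) (blk d i u) > 0"
    if "i < n" "blk d i u \<noteq> 0\<^sub>v (d i)" for i
    using A[OF that(1)] that(2) by (simp add: pos_def_mat_def)
  have "scalar_prod (A i *\<^sub>v blk d i u) (blk d i u) \<ge> 0" if "i < n" for i
  proof (cases "blk d i u = 0\<^sub>v (d i)")
    case True
    have "A i *\<^sub>v blk d i u \<in> carrier_vec (d i)"
      using A[OF that] by (auto simp: pos_def_mat_def intro: mult_mat_vec_carrier)
    then show ?thesis
      using True by simp
  qed (use pos that in force)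
  moreover obtain i where "i < n" "blk d i u \<noteq> 0\<^sub>v (d i)"
    using blk_zeroD[OF dim] u by metis
  ultimately show ?thesis
    using pos unfolding blk_form_def by (intro sum_pos2[of _ i]) auto
qed

lemma pos_def_mat_smult:
  assumes "pos_def_mat m A" and "r > 0"
  shows "pos_def_mat m (r \<cdot>\<^sub>m A)"
proof -
  have A: "A \<in> carrier_mat m m"
    using assms by (simp add: pos_def_mat_def)
  have "transpose_mat (r \<cdot>\<^sub>m A) = r \<cdot>\<^sub>m transpose_mat A"
    by (intro eq_matI) auto
  moreover have "scalar_prod ((r \<cdot>\<^sub>m A) *\<^sub>v t) t = r * scalar_prod (A *\<^sub>v t) t"
    if "t \<in> carrier_vec m" for t
  proof -
    have "(r \<cdot>\<^sub>m A) *\<^sub>v t = r \<cdot>\<^sub>v (A *\<^sub>v t)"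
      using A that by (intro eq_vecI) auto
    moreover have "A *\<^sub>v t \<in> carrier_vec m"
      using A that by simp
    ultimately show ?thesis
      using that by (simp add: smult_scalar_prod_distrib)
  qed
  ultimately show ?thesis
    using assms by (auto simp: pos_def_mat_def)
qed

text \<open>Written as an equality with a singleton, this gives existence and uniqueness of the
  iterates at once.\<close>

lemma recurrence_unique_solution:
  "{z. z 0 = x0 \<and> (\<forall>k. z (Suc k) = F (z k))} = {\<lambda>k. (F ^^ k) x0}"
proof -
  have "z k = (F ^^ k) x0" if "z 0 = x0" "\<forall>k. z (Suc k) = F (z k)" for z k
    using that by (induction k) simp_all
  then show ?thesis
    by auto
qed

text \<open>A run only asks for some minimizer in each step, so equal sets of runs could both be
  empty. The common singleton also says that both methods are well defined and
  deterministic.\<close>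

theorem theorem8:
  fixes f \<Psi> :: "('N::{finite,linorder}) rvec \<Rightarrow> real"
    and f' :: "'N rvec \<Rightarrow> 'N rvec"
    and n \<omega> :: nat and d :: "nat \<Rightarrow> nat"
    and B :: "nat \<Rightarrow> real Matrix.mat" and L :: "nat \<Rightarrow> real"
    and C :: "nat \<Rightarrow> 'N rvec \<Rightarrow> real Matrix.mat" and \<theta> :: real
    and x0 :: "'N rvec"
  assumes dim: "CARD('N) = (\<Sum>i<n. d i)"
    and B_pos_def: "\<And>i. i < n \<Longrightarrow> pos_def_mat (d i) (B i)"
    and f_smooth_convex: "smooth_convex f"
    and f'_gradient: "\<And>x. GDERIV f x :> f' x"
    and omega: "\<omega> \<ge> 1"
    and f_separable: "partially_separable n d \<omega> f"
    and L_pos: "\<And>i. i < n \<Longrightarrow> L i > 0"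
    and f_lipschitz: "block_lipschitz_grad n d B L f'"
    and Psi_zero: "\<And>x. \<Psi> x = 0"
    and C_choice: "\<And>i x. i < n \<Longrightarrow> C i x = L i \<cdot>\<^sub>m B i"
    and theta_choice: "\<theta> = 1 / real \<omega>"
  shows "\<exists>x. {z. sqa_run n d C \<theta> f f' \<Psi> x0 z} = {x} \<and> {z. pcdm_run n d B L \<omega> f f' \<Psi> x0 z} = {x}"
proof -
  define A where "A i = L i \<cdot>\<^sub>m B i" for i
  define b where "b = (blk_form n d A :: 'N rvec \<Rightarrow> 'N rvec \<Rightarrow> real)"
  have A: "pos_def_mat (d i) (A i)" if "i < n" for i
    using that B_pos_def L_pos by (simp add: A_def pos_def_mat_smult)
  have bilin: "bilinear b"
    unfolding b_def using A by (intro bilinear_blk_form) (simp add: pos_def_mat_def)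
  have sym: "b u v = b v u" for u v
    unfolding b_def using A by (intro blk_form_sym) (simp_all add: pos_def_mat_def)
  have pos: "b u u > 0" if "u \<noteq> 0" for u
    unfolding b_def using dim A that by (rule blk_form_pos)
  \<comment> \<open>The representing vector is taken for \<open>- f' x\<close>. It does not involve
    the curvature factor, so one function \<open>p\<close> serves both methods.\<close>
  have "\<forall>x. \<exists>p. \<forall>v. b p v = - (f' x \<bullet> v)"
    by (metis bilinear_form_representation[OF bilin pos] inner_minus_left)
  then obtain p where p: "\<And>x v. b (p x) v = - (f' x \<bullet> v)"
    by metis
  have sqa: "is_arg_min (sqa_model n d C f f' \<Psi> x) (\<lambda>_. True) h \<longleftrightarrow> h = p x" for x h
  proof -
    have "sqa_model n d C f f' \<Psi> x = (\<lambda>h. f x + f' x \<bullet> h + 1 / 2 * b h h)"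
      by (simp add: sqa_model_def fun_eq_iff Psi_zero b_def blk_form_def A_def C_choice)
    then show ?thesis
      using quadratic_model_minimizer[OF bilin sym pos p, of 1 "f x" x h] by simp
  qed
  have pcdm: "is_arg_min (pcdm_model n d B L \<omega> f f' \<Psi> x) (\<lambda>_. True) h
      \<longleftrightarrow> h = (1 / real \<omega>) *\<^sub>R p x" for x h
  proof -
    have "pcdm_model n d B L \<omega> f f' \<Psi> x = (\<lambda>h. f x + f' x \<bullet> h + real \<omega> / 2 * b h h)"
      by (simp add: pcdm_model_def fun_eq_iff Psi_zero b_def blk_form_def A_def)
    then show ?thesis
      using quadratic_model_minimizer[OF bilin sym pos p, of "real \<omega>" "f x" x h] omega by simp
  qed
  \<comment> \<open>The common update: averaging \<open>x\<close> and \<open>x + p x\<close> with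
    weight \<open>\<theta>\<close> moves by \<open>\<theta> *\<^sub>R p x\<close>, and
    \<open>\<theta> = 1 / real \<omega>\<close> makes this the full step of Method II.\<close>
  define F where "F x = x + (1 / real \<omega>) *\<^sub>R p x" for x
  have step: "(1 - \<theta>) *\<^sub>R x + \<theta> *\<^sub>R (x + p x) = F x" for x
    by (simp add: F_def theta_choice algebra_simps)
  \<comment> \<open>With the minimizer unique, the existential quantifiers over \<open>h\<close> and
    \<open>y\<close> in a run collapse, leaving a deterministic recurrence.\<close>
  have "sqa_run n d C \<theta> f f' \<Psi> x0 z \<longleftrightarrow> z 0 = x0 \<and> (\<forall>k. z (Suc k) = F (z k))" for z
    by (simp add: sqa_run_def sqa step)
  moreover have "pcdm_run n d B L \<omega> f f' \<Psi> x0 z \<longleftrightarrow> z 0 = x0 \<and> (\<forall>k. z (Suc k) = F (z k))" for z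
    by (simp add: pcdm_run_def pcdm F_def)
  ultimately show ?thesis
    by (simp add: recurrence_unique_solution)
qed

end
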